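(* Let $X$ and $Y$ be locally compact, complete, and separable metric spaces. Let $\pi: X \to Y$ be a Borel map, $\mu \in \mathcal{M}_{+}(X)$, $\mathrm{vol}_Y$ the volume measure on $Y$, and $\nu := \pi_{*}\mu$. If $\nu \ll \mathrm{vol}_Y$, then the disintegration map of $\mu$ with respect to $\nu$ is nearly weakly continuous.
   Context: $\mathcal{M}_{+}(X)$ is the set of positive finite Radon measures on $X$; $\mathscr{P}(X)$ the set of Borel probability measures on $X$. $\mathrm{vol}_Y$ is a reference Borel measure on $Y$, called the volume measure. Disintegration: a family $\{\mu_y\}_{y\in Y}\subset \mathcal{M}_+(X)$ such that $y\mapsto\mu_y(A)$ is Borel for every Borel $A\subset X$, $\mu_y\in\mathscr{P}(X)$ for $\nu$-a.e. $y$, $\mu(A)=\int_Y\mu_y(A)\,d\nu(y)$ for all Borel $A\subset X$, and $\mu_y$ is concentrated on $\pi^{-1}(y)$ for $\nu$-a.e. $y$ (such a family exists for $X,Y$ locally compact separable metric spaces). The disintegration map of $\mu$ w.r.t. $\nu$ is $f:Y\to\mathscr{P}(X)$, $f(y)=\mu_y$. $f$ is nearly weakly continuous if for each $\varepsilon>0$ there exists a closed set $\mathcal{K}\subset Y$ with $\nu(Y\setminus\mathcal{K})<\varepsilon$ such that the restriction of $f$ to $\mathcal{K}$ is continuous with respect to weak convergence of measures on $\mathscr{P}(X)$ (convergence of integrals of bounded continuous functions). *)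

theory Defs
  imports "HOL-Probability.Probability"
begin

definition finite_radon_measure :: "'a::topological_space measure \<Rightarrow> bool" where
  "finite_radon_measure M \<longleftrightarrow>
     sets M = sets borel \<and> finite_measure M \<and>
     (\<forall>A\<in>sets borel. emeasure M A = (SUP K\<in>{K. K \<subseteq> A \<and> compact K}. emeasure M K))"

text \<open>In the last clause, that \<open>\<mu>s y\<close> is concentrated on the fibre over \<open>y\<close> means that the
  complement of the fibre is a null set.\<close>

definition is_disintegration ::
  "'a::topological_space measure \<Rightarrow> 'b::topological_space measure \<Rightarrow> ('a \<Rightarrow> 'b) \<Rightarrow> ('b \<Rightarrow> 'a measure) \<Rightarrow> bool"
where
  "is_disintegration \<mu> \<nu> \<pi> \<mu>s \<longleftrightarrow>
     (\<forall>y. finite_radon_measure (\<mu>s y)) \<and>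
     (\<forall>A\<in>sets borel. (\<lambda>y. emeasure (\<mu>s y) A) \<in> borel_measurable borel) \<and>
     (AE y in \<nu>. \<mu>s y \<in> space (prob_algebra borel)) \<and>
     (\<forall>A\<in>sets borel. emeasure \<mu> A = (\<integral>\<^sup>+y. emeasure (\<mu>s y) A \<partial>\<nu>)) \<and>
     (AE y in \<nu>. emeasure (\<mu>s y) (UNIV - \<pi> -` {y}) = 0)"

text \<open>The library's \<open>weak_conv_m\<close> is defined through distribution functions and only for
  measures on the real line.\<close>

definition weakly_tendsto ::
  "('i \<Rightarrow> 'a::topological_space measure) \<Rightarrow> 'a measure \<Rightarrow> 'i filter \<Rightarrow> bool"
where
  "weakly_tendsto Ms M F \<longleftrightarrow>
     (\<forall>\<phi>::'a \<Rightarrow> real. continuous_on UNIV \<phi> \<and> bounded (range \<phi>) \<longrightarrow>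
        ((\<lambda>i. integral\<^sup>L (Ms i) \<phi>) \<longlongrightarrow> integral\<^sup>L M \<phi>) F)"

text \<open>A disintegration map takes values in the probability measures only almost everywhere.
  Its restriction to \<open>K\<close> is required to be a map into the space of Borel probability
  measures, so \<open>K\<close> has to avoid the exceptional points.\<close>

definition nearly_weakly_continuous ::
  "'b::topological_space measure \<Rightarrow> ('b \<Rightarrow> 'a::topological_space measure) \<Rightarrow> bool"
where
  "nearly_weakly_continuous \<nu> f \<longleftrightarrow>
     (\<forall>\<epsilon>>0. \<exists>K. closed K \<and> emeasure \<nu> (UNIV - K) < ennreal \<epsilon> \<and>
        (\<forall>y\<in>K. f y \<in> space (prob_algebra borel)) \<and>
        (\<forall>y\<in>K. weakly_tendsto f (f y) (at y within K)))"

end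

theory Submission
  imports Defs
begin

text \<open>Choose a countable base of open sets of \<open>X\<close> closed under finite unions. The countably many
  Borel sets \<open>{y. q < f y U}\<close>, with \<open>U\<close> in the base and \<open>q\<close> rational, become relatively clopen
  on a closed set \<open>K\<close> of almost full measure, as in the proof of Lusin's theorem. On \<open>K\<close> the map
  \<open>y \<mapsto> f y U\<close> is then lower semicontinuous for basic \<open>U\<close>, hence by inner regularity of \<open>f y\<close> for
  every open \<open>U\<close>, and the portmanteau theorem turns this into weak continuity.\<close>

section \<open>Closed sets in the manner of Lusin, and a countable family of open sets\<close>

text \<open>Finite Borel measures on Polish spaces are inner regular with respect to compact sets,
  and compact sets are closed here.\<close>

lemma closed_inner_approximation:
  fixes M :: "'a::polish_space measure"
  assumes fin: "finite_measure M" and sets: "sets M = sets borel"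
    and B: "B \<in> sets borel" and e: "0 < e"
  shows "\<exists>C. closed C \<and> C \<subseteq> B \<and> measure M (B - C) < e"
\<comment> \<open>The null case is split off because \<open>ennreal\<close> truncates negative reals
  to 0: for a null \<open>B\<close> the strict inequality that starts the other case would read 0 <
  0.\<close>
proof (cases "measure M B = 0")
  case True
  then show ?thesis using e by (intro exI[of _ "{}"]) simp
next
  case False
  interpret finite_measure M by fact
  from False have pos: "0 < measure M B" by (simp add: zero_less_measure_iff)
  have sp: "space M = UNIV" using sets_eq_imp_space_eq[OF sets] by simp
  have "ennreal (measure M B - e) < emeasure M B"
    using e pos by (simp add: emeasure_eq_measure ennreal_less_iff ennreal_lessI)
  also have "emeasure M B = (SUP K\<in>{K. K \<subseteq> B \<and> compact K}. emeasure M K)"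
    by (rule inner_regular[OF sets _ B]) simp
  finally obtain K where K: "K \<subseteq> B" "compact K" "ennreal (measure M B - e) < emeasure M K"
    by (auto simp: less_SUP_iff)
  then have "closed K" by (simp add: compact_imp_closed)
  moreover have "measure M B - e < measure M K"
    using K(3) by (metis emeasure_eq_measure ennreal_leI linorder_not_le)
  moreover have "measure M (B - K) = measure M B - measure M K"
    using K \<open>closed K\<close> B by (intro finite_measure_Diff) (auto simp: sets)
  ultimately show ?thesis using K by (intro exI[of _ K]) auto
qed

text \<open>Each set and its complement are approximated from inside by closed sets
  \<open>C n\<close> and \<open>D n\<close>. On the intersection \<open>K\<close> of the unions
  \<open>C n \<union> D n\<close>, membership in \<open>A n\<close> coincides with membership in
  \<open>C n\<close>, and non-membership with membership in \<open>D n\<close>.\<close>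

lemma countable_relatively_clopen:
  fixes M :: "'a::polish_space measure"
  assumes fin: "finite_measure M" and sets: "sets M = sets borel" and \<A>: "countable \<A>" "\<A> \<subseteq> sets borel" and e: "0 < e"
  shows "\<exists>K. closed K \<and> measure M (- K) < e \<and> (\<forall>A\<in>\<A>. closed (K \<inter> A) \<and> closed (K - A))"
proof -
  interpret finite_measure M by fact
  \<comment> \<open>Inserting the empty set keeps the enumerated family nonempty, so that its range
    is the whole family even if \<open>\<A>\<close> is empty.\<close>
  define A where "A = from_nat_into (insert {} \<A>)"
  have range_A: "range A = insert {} \<A>"
    unfolding A_def using \<A> by (intro range_from_nat_into) auto
  then have A: "A n \<in> sets borel" for n
    using \<A> rangeI[of A n] by auto
  \<comment> \<open>Every index costs at most \<open>2 * d n\<close>, once for \<open>C n\<close>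
    and once for \<open>D n\<close>; the total is e/2, strictly below \<open>e\<close>.\<close>
  define d where "d n = e / 4 * (1 / 2) ^ Suc n" for n
  have d: "0 < d n" for n using e by (simp add: d_def)
  have "\<forall>n. \<exists>C. closed C \<and> C \<subseteq> A n \<and> measure M (A n - C) < d n"
    using closed_inner_approximation[OF fin sets A d] by blast
  then obtain C where C: "\<And>n. closed (C n)" "\<And>n. C n \<subseteq> A n" "\<And>n. measure M (A n - C n) < d n"
    by metis
  have "\<forall>n. \<exists>D. closed D \<and> D \<subseteq> - A n \<and> measure M (- A n - D) < d n"
    using closed_inner_approximation[OF fin sets borel_comp[OF A] d] by blast
  then obtain D where D: "\<And>n. closed (D n)" "\<And>n. D n \<subseteq> - A n" "\<And>n. measure M (- A n - D n) < d n"
    by metis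
  define K where "K = (\<Inter>n. C n \<union> D n)"
  have closed: "closed K"
    unfolding K_def using C(1) D(1) by auto
  have meas: "A n - C n \<in> sets M" "- A n - D n \<in> sets M" for n
    using A[of n] C(1)[of n] D(1)[of n] by (auto simp: sets)
  have d_sums: "(\<lambda>n. 2 * d n) sums (2 * (e / 4 * 1))"
    unfolding d_def by (intro sums_mult power_half_series)
  have le: "measure M ((A n - C n) \<union> (- A n - D n)) \<le> 2 * d n" for n
    using measure_Un_le[OF meas(1)[of n] meas(2)[of n]] C(3)[of n] D(3)[of n] by simp
  have summable: "summable (\<lambda>n. measure M ((A n - C n) \<union> (- A n - D n)))"
    by (rule summable_comparison_test[OF _ sums_summable[OF d_sums]]) (use le in auto)
  have "measure M (- K) \<le> measure M (\<Union>n. (A n - C n) \<union> (- A n - D n))"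
    using meas by (intro finite_measure_mono) (auto simp: K_def)
  also have "\<dots> \<le> (\<Sum>n. measure M ((A n - C n) \<union> (- A n - D n)))"
    using meas summable by (intro finite_measure_subadditive_countably) auto
  also have "\<dots> \<le> (\<Sum>n. 2 * d n)"
    by (intro suminf_le le summable sums_summable[OF d_sums])
  also have "\<dots> < e" using sums_unique[OF d_sums] e by simp
  finally have "measure M (- K) < e" .
  moreover have "closed (K \<inter> A n) \<and> closed (K - A n)" for n
  proof -
    have "K \<inter> A n = K \<inter> C n" "K - A n = K \<inter> D n"
      using C(2)[of n] D(2)[of n] by (auto simp: K_def)
    then show ?thesis using closed C(1) D(1) by auto
  qed
  moreover have "\<exists>n. B = A n" if "B \<in> \<A>" for B
    using that range_A by blast
  ultimately show ?thesis
    using closed by metis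
qed

text \<open>The finite unions of members of a countable basis form such a family: \<open>V\<close>
  is a union of basic sets, and finitely many of them already cover \<open>K\<close>. Combined with
  inner regularity, this lets countably many open sets control the mass of every open set.\<close>

lemma ex_countable_base_compact_open:
  "\<exists>\<U> :: 'a::second_countable_topology set set. countable \<U> \<and> (\<forall>U\<in>\<U>. open U) \<and>
     (\<forall>K V. compact K \<longrightarrow> open V \<longrightarrow> K \<subseteq> V \<longrightarrow> (\<exists>U\<in>\<U>. K \<subseteq> U \<and> U \<subseteq> V))"
proof -
  obtain B :: "'a set set" where B: "countable B" "topological_basis B"
    using ex_countable_basis by blast
  define \<U> where "\<U> = Union ` {F. finite F \<and> F \<subseteq> B}"
  have "countable \<U>"
    unfolding \<U>_def using countable_Collect_finite_subset[OF B(1)] by simp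
  moreover have "open U" if "U \<in> \<U>" for U
    using that topological_basis_open[OF B(2)] by (auto simp: \<U>_def)
  moreover have "\<exists>U\<in>\<U>. K \<subseteq> U \<and> U \<subseteq> V" if "compact K" "open V" "K \<subseteq> V" for K V
  proof -
    obtain B' where B': "B' \<subseteq> B" "\<Union>B' = V"
      using B(2) \<open>open V\<close> unfolding topological_basis_def by blast
    have "\<And>b. b \<in> B' \<Longrightarrow> open b" using B' topological_basis_open[OF B(2)] by blast
    then obtain F where "F \<subseteq> B'" "finite F" "K \<subseteq> \<Union>F"
      using compactE[OF \<open>compact K\<close>, of B'] \<open>K \<subseteq> V\<close> B'(2) by auto
    then show ?thesis
      using B' unfolding \<U>_def by (intro bexI[of _ "\<Union>F"]) auto
  qed
  ultimately show ?thesis by blast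
qed

section \<open>Weak convergence from lower semicontinuity on open sets\<close>

text \<open>The sum equals \<open>\<lceil>N * t\<rceil>\<close>.\<close>

lemma layer_sum_bounds:
  fixes t :: real
  assumes "0 \<le> t" "t \<le> 1" "0 < N"
  shows "t \<le> (\<Sum>i<N. of_bool (real i / real N < t)) / real N"
    and "(\<Sum>i<N. of_bool (real i / real N < t)) / real N \<le> t + 1 / real N"
proof -
  have iff: "real i / real N < t \<longleftrightarrow> i < nat \<lceil>real N * t\<rceil>" for i
  proof -
    have "real i / real N < t \<longleftrightarrow> real i < real N * t"
      using \<open>0 < N\<close> by (simp add: pos_divide_less_eq mult.commute)
    also have "\<dots> \<longleftrightarrow> i < nat \<lceil>real N * t\<rceil>" by linarith
    finally show ?thesis .
  qed
  have "real N * t \<le> real N" using assms by (simp add: mult_left_le)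
  then have "nat \<lceil>real N * t\<rceil> \<le> N" by linarith
  then have "{..<N} \<inter> {i. i < nat \<lceil>real N * t\<rceil>} = {..<nat \<lceil>real N * t\<rceil>}"
    by (auto simp del: nat_ceiling_le_eq)
  then have eq: "(\<Sum>i<N. of_bool (real i / real N < t)) = real (nat \<lceil>real N * t\<rceil>)"
    unfolding iff of_bool_def by (subst sum.If_cases) simp_all
  have "0 \<le> real N * t" using assms by simp
  then have "real N * t \<le> real (nat \<lceil>real N * t\<rceil>)" "real (nat \<lceil>real N * t\<rceil>) \<le> real N * t + 1"
    by linarith+
  then show "t \<le> (\<Sum>i<N. of_bool (real i / real N < t)) / real N"
    and "(\<Sum>i<N. of_bool (real i / real N < t)) / real N \<le> t + 1 / real N"
    unfolding eq using assms by (simp_all add: field_simps)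
qed

text \<open>A discrete layer-cake formula, obtained by integrating the pointwise bounds of
  \<open>layer_sum_bounds\<close>. It expresses the integral, up to 1/N, through finitely many
  superlevel sets, which are open when \<open>\<phi>\<close> is continuous.\<close>

lemma (in prob_space) integral_layer_bounds:
  fixes \<phi> :: "'a \<Rightarrow> real"
  assumes \<phi>: "\<phi> \<in> borel_measurable M" "\<And>x. 0 \<le> \<phi> x" "\<And>x. \<phi> x \<le> 1" and N: "0 < N"
  shows "integral\<^sup>L M \<phi> \<le> (\<Sum>i<N. measure M {x\<in>space M. real i / real N < \<phi> x}) / real N"
    and "(\<Sum>i<N. measure M {x\<in>space M. real i / real N < \<phi> x}) / real N \<le> integral\<^sup>L M \<phi> + 1 / real N"
proof -
  define S where "S x = (\<Sum>i<N. indicat_real {x\<in>space M. real i / real N < \<phi> x} x) / real N" for x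
  have S: "S x = (\<Sum>i<N. of_bool (real i / real N < \<phi> x)) / real N" if "x \<in> space M" for x
    unfolding S_def using that by (simp add: indicator_def)
  have int: "integrable M \<phi>"
    using \<phi> by (intro integrable_const_bound[where B=1]) auto
  have intS: "integrable M S"
    unfolding S_def using \<phi>(1)
    by (intro integrable_divide Bochner_Integration.integrable_sum integrable_real_indicator)
      (auto simp: emeasure_eq_measure)
  have eq: "integral\<^sup>L M S = (\<Sum>i<N. measure M {x\<in>space M. real i / real N < \<phi> x}) / real N"
    unfolding S_def using \<phi>(1)
    by (subst integral_divide_zero, subst Bochner_Integration.integral_sum)
      (auto simp: emeasure_eq_measure Int_def intro!: integrable_real_indicator sum.cong arg_cong[where f="measure M"])
  show "integral\<^sup>L M \<phi> \<le> (\<Sum>i<N. measure M {x\<in>space M. real i / real N < \<phi> x}) / real N"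
    unfolding eq[symmetric] using layer_sum_bounds(1)[OF \<phi>(2,3) N] S
    by (intro integral_mono int intS) auto
  have "integral\<^sup>L M S \<le> (\<integral>x. \<phi> x + 1 / real N \<partial>M)"
    using layer_sum_bounds(2)[OF \<phi>(2,3) N] S
    by (intro integral_mono intS Bochner_Integration.integrable_add int) auto
  also have "\<dots> = integral\<^sup>L M \<phi> + 1 / real N"
    by (subst Bochner_Integration.integral_add) (auto simp: int prob_space)
  finally show "(\<Sum>i<N. measure M {x\<in>space M. real i / real N < \<phi> x}) / real N \<le> integral\<^sup>L M \<phi> + 1 / real N"
    unfolding eq .
qed

text \<open>The layer sum involves only finitely many open sets, so lower semicontinuity applies to
  all of them simultaneously.\<close>

lemma integral_lower_semicontinuous_unit:
  fixes Ms :: "'i \<Rightarrow> 'a::topological_space measure" and \<phi> :: "'a \<Rightarrow> real"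
  assumes Ms: "eventually (\<lambda>i. Ms i \<in> space (prob_algebra borel)) F"
    and M: "M \<in> space (prob_algebra borel)"
    and lsc: "\<And>U q. open U \<Longrightarrow> q < measure M U \<Longrightarrow> eventually (\<lambda>i. q < measure (Ms i) U) F"
    and \<phi>: "continuous_on UNIV \<phi>" "\<And>x. 0 \<le> \<phi> x" "\<And>x. \<phi> x \<le> 1"
    and q: "q < integral\<^sup>L M \<phi>"
  shows "eventually (\<lambda>i. q < integral\<^sup>L (Ms i) \<phi>) F"
proof -
  define e where "e = integral\<^sup>L M \<phi> - q"
  have e: "0 < e" using q by (simp add: e_def)
  \<comment> \<open>Half of the gap \<open>e\<close> absorbs the discretisation error 1/N; the other
    half is spent on the layers.\<close>
  obtain N where N: "0 < N" "1 / real N < e / 2"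
    using e real_arch_inverse[of "e/2"] by (auto simp: inverse_eq_divide)
  have op: "open {x. real i / real N < \<phi> x}" for i
    by (intro open_Collect_less \<phi> continuous_on_const)
  have layer:
    "integral\<^sup>L P \<phi> \<le> (\<Sum>i<N. measure P {x. real i / real N < \<phi> x}) / real N"
    "(\<Sum>i<N. measure P {x. real i / real N < \<phi> x}) / real N \<le> integral\<^sup>L P \<phi> + 1 / real N"
    if "P \<in> space (prob_algebra borel)" for P :: "'a measure"
  proof -
    have P: "prob_space P" "sets P = sets borel" using that by (auto simp: space_prob_algebra)
    have sp: "space P = UNIV" using sets_eq_imp_space_eq[OF P(2)] by simp
    have "\<phi> \<in> borel_measurable P"
      using borel_measurable_continuous_onI[OF \<phi>(1)] measurable_cong_sets[OF P(2) refl] by blast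
    from prob_space.integral_layer_bounds[OF P(1) this \<phi>(2,3) N(1)]
    show "integral\<^sup>L P \<phi> \<le> (\<Sum>i<N. measure P {x. real i / real N < \<phi> x}) / real N"
      "(\<Sum>i<N. measure P {x. real i / real N < \<phi> x}) / real N \<le> integral\<^sup>L P \<phi> + 1 / real N"
      by (simp_all add: sp)
  qed
  have "eventually (\<lambda>i. \<forall>k\<in>{..<N}. measure M {x. real k / real N < \<phi> x} - e / 2
      < measure (Ms i) {x. real k / real N < \<phi> x}) F"
    using e by (intro eventually_ball_finite ballI lsc op) auto
  with Ms show ?thesis
  proof eventually_elim
    case (elim i)
    have "q = integral\<^sup>L M \<phi> - e" by (simp add: e_def)
    also have "\<dots> \<le> (\<Sum>k<N. measure M {x. real k / real N < \<phi> x}) / real N - e"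
      using layer(1)[OF M] by simp
    \<comment> \<open>A loss of e/2 in each of the \<open>N\<close> layers averages to e/2 after
      division by \<open>N\<close>.\<close>
    also have "\<dots> = (\<Sum>k<N. measure M {x. real k / real N < \<phi> x} - e / 2) / real N - e / 2"
      unfolding sum_subtractf using N(1) by (simp add: field_simps)
    also have "\<dots> \<le> (\<Sum>k<N. measure (Ms i) {x. real k / real N < \<phi> x}) / real N - e / 2"
      using elim(2) by (intro diff_right_mono divide_right_mono sum_mono) (auto intro: less_imp_le)
    also have "\<dots> \<le> integral\<^sup>L (Ms i) \<phi> + 1 / real N - e / 2"
      using layer(2)[OF elim(1)] by simp
    also have "\<dots> < integral\<^sup>L (Ms i) \<phi>" using N(2) by simp
    finally show ?case .
  qed
qed

text \<open>One implication of the portmanteau theorem. Lower semicontinuity of the integrals of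
  both \<open>\<phi>\<close> and its negative gives convergence; an affine rescaling brings either
  function into the unit interval.\<close>

lemma weakly_tendsto_if_open_lower_semicontinuous:
  fixes Ms :: "'i \<Rightarrow> 'a::topological_space measure"
  assumes Ms: "eventually (\<lambda>i. Ms i \<in> space (prob_algebra borel)) F"
    and M: "M \<in> space (prob_algebra borel)"
    and lsc: "\<And>U q. open U \<Longrightarrow> q < measure M U \<Longrightarrow> eventually (\<lambda>i. q < measure (Ms i) U) F"
  shows "weakly_tendsto Ms M F"
  unfolding weakly_tendsto_def
proof (intro allI impI, elim conjE)
  fix \<phi> :: "'a \<Rightarrow> real"
  assume cont: "continuous_on UNIV \<phi>" and bdd: "bounded (range \<phi>)"
  obtain b where b: "0 < b" "\<And>x. \<bar>\<phi> x\<bar> \<le> b"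
    using bdd by (auto simp: bounded_pos)
  have affine: "integral\<^sup>L P (\<lambda>x. (s * \<phi> x + b) / (2 * b)) = (s * integral\<^sup>L P \<phi> + b) / (2 * b)"
    if "P \<in> space (prob_algebra borel)" for P :: "'a measure" and s
  proof -
    interpret prob_space P using that by (auto simp: space_prob_algebra)
    have sets: "sets P = sets borel" using that by (auto simp: space_prob_algebra)
    have "\<phi> \<in> borel_measurable P"
      using borel_measurable_continuous_onI[OF cont] measurable_cong_sets[OF sets refl] by blast
    then have int: "integrable P \<phi>"
      using b by (intro integrable_const_bound[where B=b]) auto
    then show ?thesis
      by (subst integral_divide_zero, subst Bochner_Integration.integral_add) (auto simp: prob_space)
  qed
  \<comment> \<open>The sign \<open>s\<close> treats both one-sided bounds at once: 1 yields the
    lower bound and -1 the upper one.\<close>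
  have low: "eventually (\<lambda>i. q < s * integral\<^sup>L (Ms i) \<phi>) F"
    if s: "\<bar>s\<bar> = 1" and q: "q < s * integral\<^sup>L M \<phi>" for s q
  proof -
    have sb: "\<bar>s * \<phi> x\<bar> \<le> b" for x using b(2)[of x] s by (simp add: abs_mult)
    have "eventually (\<lambda>i. (q + b) / (2 * b) < integral\<^sup>L (Ms i) (\<lambda>x. (s * \<phi> x + b) / (2 * b))) F"
    proof (rule integral_lower_semicontinuous_unit[OF Ms M lsc])
      show "continuous_on UNIV (\<lambda>x. (s * \<phi> x + b) / (2 * b))"
        using b(1) by (intro continuous_intros cont) auto
      show "0 \<le> (s * \<phi> x + b) / (2 * b)" "(s * \<phi> x + b) / (2 * b) \<le> 1" for x
        using sb[of x] b(1) by (auto simp: divide_le_eq intro!: divide_nonneg_pos)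
      show "(q + b) / (2 * b) < integral\<^sup>L M (\<lambda>x. (s * \<phi> x + b) / (2 * b))"
        unfolding affine[OF M] using q b(1) by (simp add: divide_strict_right_mono)
    qed
    with Ms show ?thesis
    proof eventually_elim
      case (elim i)
      then show ?case unfolding affine[OF elim(1)] using b(1) by (simp add: divide_less_cancel)
    qed
  qed
  show "((\<lambda>i. integral\<^sup>L (Ms i) \<phi>) \<longlongrightarrow> integral\<^sup>L M \<phi>) F"
  proof (rule order_tendstoI)
    fix a assume "a < integral\<^sup>L M \<phi>"
    then show "eventually (\<lambda>i. a < integral\<^sup>L (Ms i) \<phi>) F"
      using low[of 1 a] by simp
  next
    fix a assume "integral\<^sup>L M \<phi> < a"
    then show "eventually (\<lambda>i. integral\<^sup>L (Ms i) \<phi> < a) F"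
      using low[of "-1" "-a"] by simp
  qed
qed

section \<open>The Lusin argument for measure-valued maps\<close>

text \<open>Isolates what the argument needs from a disintegration: masses of open sets depend
  measurably on the point, and almost every value is a probability measure.\<close>

lemma nearly_weakly_continuous_if_borel:
  fixes f :: "'y::polish_space \<Rightarrow> 'x::polish_space measure"
  assumes fin: "finite_measure \<nu>" and sets: "sets \<nu> = sets borel"
    and meas: "\<And>U. open U \<Longrightarrow> (\<lambda>y. emeasure (f y) U) \<in> borel_measurable borel"
    and fsets: "\<And>y. sets (f y) = sets borel"
    and prob: "AE y in \<nu>. f y \<in> space (prob_algebra borel)"
  shows "nearly_weakly_continuous \<nu> f"
  unfolding nearly_weakly_continuous_def
proof (intro allI impI)
  fix e :: real assume e: "0 < e"
  interpret finite_measure \<nu> by fact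
  have sp: "space \<nu> = UNIV" using sets_eq_imp_space_eq[OF sets] by simp
  obtain \<U> :: "'x set set" where \<U>: "countable \<U>" "\<And>U. U \<in> \<U> \<Longrightarrow> open U"
    "\<And>K V. compact K \<Longrightarrow> open V \<Longrightarrow> K \<subseteq> V \<Longrightarrow> \<exists>U\<in>\<U>. K \<subseteq> U \<and> U \<subseteq> V"
    using ex_countable_base_compact_open by metis
  define P where "P = {y. f y \<in> space (prob_algebra borel)}"
  have P_iff: "y \<in> P \<longleftrightarrow> emeasure (f y) UNIV = 1" for y
  proof -
    have "space (f y) = UNIV" using sets_eq_imp_space_eq[OF fsets[of y]] by simp
    then have "prob_space (f y) \<longleftrightarrow> emeasure (f y) UNIV = 1"
      using prob_spaceI[of "f y"] prob_space.emeasure_space_1[of "f y"] by metis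
    then show ?thesis using fsets[of y] by (simp add: P_def space_prob_algebra)
  qed
  have P_eq: "P = {y. emeasure (f y) UNIV = 1}" using P_iff by blast
  have P: "P \<in> sets borel"
    unfolding P_eq using meas[of UNIV] by measurable
  define S where "S = (\<lambda>(U, q). {y. ennreal (real_of_rat q) < emeasure (f y) U})"
  \<comment> \<open>Rational thresholds keep the family countable. Including \<open>P\<close> makes
    \<open>L \<inter> P\<close> closed, so the exceptional points can be removed from
    \<open>L\<close> without losing closedness.\<close>
  define \<A> where "\<A> = insert P (S ` (\<U> \<times> UNIV))"
  have S: "S (U, q) \<in> sets borel" if "U \<in> \<U>" for U q
    unfolding S_def prod.case using meas[OF \<U>(2)[OF that]] by measurable
  have "countable \<A>" "\<A> \<subseteq> sets borel"
    using \<U>(1) S P by (auto simp: \<A>_def)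
  from countable_relatively_clopen[OF fin sets this e] obtain L where L: "closed L"
    "measure \<nu> (- L) < e" "\<And>A. A \<in> \<A> \<Longrightarrow> closed (L \<inter> A) \<and> closed (L - A)"
    by blast
  define K where "K = L \<inter> P"
  have K: "closed K" using L(3)[of P] by (simp add: K_def \<A>_def)
  have null: "AE y in \<nu>. y \<in> P" using prob by (simp add: P_def)
  \<comment> \<open>Passing from \<open>L\<close> to \<open>K\<close> discards only a null
    set.\<close>
  have "emeasure \<nu> (UNIV - K) = emeasure \<nu> (- L)"
    using null L(1) P K by (intro emeasure_eq_AE) (auto simp: K_def sets)
  also have "\<dots> < ennreal e"
    using L(2) by (simp add: emeasure_eq_measure ennreal_lessI e)
  finally have small: "emeasure \<nu> (UNIV - K) < ennreal e" .
  have weak: "weakly_tendsto f (f y) (at y within K)" if y: "y \<in> K" for y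
  proof (rule weakly_tendsto_if_open_lower_semicontinuous)
    show Py: "f y \<in> space (prob_algebra borel)" using y by (simp add: K_def P_def)
    show "eventually (\<lambda>z. f z \<in> space (prob_algebra borel)) (at y within K)"
      by (auto simp: eventually_at_filter K_def P_def)
    fix V q assume V: "open V" and q: "q < measure (f y) V"
    interpret y: prob_space "f y" using Py by (auto simp: space_prob_algebra)
    show "eventually (\<lambda>z. q < measure (f z) V) (at y within K)"
    \<comment> \<open>A negative bound is trivial. Otherwise the rational \<open>r\<close> above
      \<open>q\<close> is nonnegative, so comparisons pass faithfully through
      \<open>ennreal\<close>.\<close>
    proof (cases "q < 0")
      case True
      then show ?thesis by (auto intro!: always_eventually less_le_trans[OF _ measure_nonneg])
    next
      case False
      obtain r where r: "q < real_of_rat r" "real_of_rat r < measure (f y) V"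
        using of_rat_dense[OF q] by blast
      have r0: "0 \<le> real_of_rat r" using r(1) False by linarith
      have "ennreal (real_of_rat r) < emeasure (f y) V"
        using r(2) by (simp add: y.emeasure_eq_measure ennreal_less_iff[OF r0])
      also have "emeasure (f y) V = (SUP C\<in>{C. C \<subseteq> V \<and> compact C}. emeasure (f y) C)"
        using V by (intro inner_regular fsets) (auto simp: y.emeasure_eq_measure)
      finally obtain C where C: "C \<subseteq> V" "compact C" "ennreal (real_of_rat r) < emeasure (f y) C"
        by (auto simp: less_SUP_iff)
      \<comment> \<open>Squeezing \<open>U\<close> between \<open>C\<close> and \<open>V\<close>
        replaces the arbitrary open set by one of the countably many handled by \<open>L\<close>: it
        still has \<open>f y\<close>-mass above \<open>r\<close>, and mass in \<open>U\<close>
        bounds mass in \<open>V\<close> from below.\<close>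
      obtain U where U: "U \<in> \<U>" "C \<subseteq> U" "U \<subseteq> V" using \<U>(3)[OF C(2) V C(1)] by blast
      have "emeasure (f y) C \<le> emeasure (f y) U"
        using U \<U>(2) by (intro emeasure_mono) (auto simp: fsets)
      with C(3) have yS: "y \<in> S (U, r)" by (auto simp: S_def)
      \<comment> \<open>Thus \<open>S (U, r)\<close> is relatively open in \<open>L\<close>, and
        points of \<open>K\<close> close to \<open>y\<close> stay in it.\<close>
      have "closed (L - S (U, r))" using L(3) U(1) by (auto simp: \<A>_def)
      then have "open (- (L - S (U, r)))" by (rule open_Compl)
      moreover have "y \<in> - (L - S (U, r))" using yS by simp
      ultimately have "eventually (\<lambda>z. z \<in> - (L - S (U, r))) (at y within K)"
        by (intro eventually_at_topological[THEN iffD2]) blast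
      moreover have "eventually (\<lambda>z. z \<in> K) (at y within K)"
        by (auto simp: eventually_at_filter)
      ultimately show ?thesis
      proof eventually_elim
        case (elim z)
        then have zS: "z \<in> S (U, r)" and zP: "f z \<in> space (prob_algebra borel)"
          by (auto simp: K_def P_def)
        interpret z: prob_space "f z" using zP by (auto simp: space_prob_algebra)
        have "ennreal (real_of_rat r) < emeasure (f z) U" using zS by (simp add: S_def)
        also have "\<dots> \<le> emeasure (f z) V"
          using U V by (intro emeasure_mono) (auto simp: fsets)
        finally have "real_of_rat r < measure (f z) V"
          by (simp add: z.emeasure_eq_measure ennreal_less_iff[OF r0])
        with r show ?case by simp
      qed
    qed
  qed
  show "\<exists>K. closed K \<and> emeasure \<nu> (UNIV - K) < ennreal e \<and>
      (\<forall>y\<in>K. f y \<in> space (prob_algebra borel)) \<and> (\<forall>y\<in>K. weakly_tendsto f (f y) (at y within K))"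
    by (intro exI[of _ K] conjI ballI K small weak) (auto simp: K_def P_def)
qed

theorem proposition5p2:
  fixes \<pi> :: "'x::polish_space \<Rightarrow> 'y::polish_space"
    and \<mu> :: "'x measure" and vol \<nu> :: "'y measure"
    and f :: "'y \<Rightarrow> 'x measure"
  assumes "locally_compact_space (euclidean :: 'x topology)"
    and "locally_compact_space (euclidean :: 'y topology)"
    and "\<pi> \<in> borel_measurable borel"
    and "finite_radon_measure \<mu>"
    and "sets vol = sets borel"
    and "\<nu> = distr \<mu> borel \<pi>"
    and "absolutely_continuous vol \<nu>"
    and "is_disintegration \<mu> \<nu> \<pi> f"
  shows "nearly_weakly_continuous \<nu> f"
proof (rule nearly_weakly_continuous_if_borel)
  have \<mu>: "finite_measure \<mu>" "sets \<mu> = sets borel"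
    using assms(4) by (auto simp: finite_radon_measure_def)
  have "\<pi> \<in> measurable \<mu> borel"
    using assms(3) measurable_cong_sets[OF \<mu>(2) refl] by blast
  then show "finite_measure \<nu>"
    unfolding assms(6) by (rule finite_measure.finite_measure_distr[OF \<mu>(1)])
  show "sets \<nu> = sets borel" by (simp add: assms(6))
\<comment> \<open>The remaining goals are clauses of the disintegration; the Borel sigma-algebra of
  each \<open>f y\<close> comes from its being a finite Radon measure.\<close>
qed (use assms(8) in \<open>auto simp: is_disintegration_def finite_radon_measure_def\<close>)

end
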